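(* Let $L_1$ be the five-dimensional complex solvable Leibniz algebra with basis $\{e_1,e_2,e_3,x_1,x_2\}$ and products $$[e_2,e_1]=e_3,\ [e_1,x_1]=e_1,\ [x_1,e_1]=-e_1,\ [e_3,x_1]=e_3,\ [e_2,x_2]=e_2,\ [e_3,x_2]=e_3,$$ with nilradical $N=\langle e_1,e_2,e_3\rangle$. Let $\widehat L_1=L_1(\omega,l,r)$ be an extension of $L_1$ by the abelian algebra $\mathfrak h=\langle e_4\rangle$ (with $N\subseteq\ker l\cap\ker r$). Then $\widehat L_1$ is isomorphic to one of the following pairwise non-isomorphic algebras (basis $\{e_1,e_2,e_3,e_4,x_1,x_2\}$, $\delta\in\mathbb C$ a parameter): $\widehat L_1^1$: the products of $L_1$ together with $[x_2,e_1]=e_4$, $[e_4,x_1]=e_4$. $\widehat L_1^2$: the products of $L_1$ together with $[e_1,e_1]=e_4$, $[e_4,x_1]=2e_4$. $\widehat L_1^3$: the products of $L_1$ together with $[e_3,e_1]=e_4$, $[e_4,x_1]=2e_4$, $[e_4,x_2]=e_4$. $\widehat L_1^4$: the products of $L_1$ together with $[e_2,x_1]=e_4$, $[e_4,x_2]=e_4$. $\widehat L_1^5(\delta)$: the products of $L_1$ with $[e_2,x_2]$ replaced by $[e_2,x_2]=e_2+e_4$, together with $[e_2,x_1]=\delta e_4$, $[e_4,x_2]=e_4$. $\widehat L_1^6$: the products of $L_1$ with $[e_1,x_1]$ and $[x_1,e_1]$ replaced by $[e_1,x_1]=e_1+e_4$, $[x_1,e_1]=-e_1-e_4$, together with $[e_4,x_1]=e_4$,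 $[x_1,e_4]=-e_4$. $\widehat L_1^7(\delta)$: the products of $L_1$ with $[e_1,x_1]$ and $[x_1,e_1]$ replaced by $[e_1,x_1]=e_1+\delta e_4$, $[x_1,e_1]=-e_1-\delta e_4$, together with $[e_1,x_2]=e_4$, $[x_2,e_1]=-e_4$, $[e_4,x_1]=e_4$, $[x_1,e_4]=-e_4$.
   Context: All algebras are over $\mathbb C$; products of basis elements not listed are zero. A (right) Leibniz algebra is a vector space with a bilinear bracket satisfying $[[x,y],z]=[x,[y,z]]+[[x,z],y]$. The nilradical is the maximal nilpotent ideal. Abelian extension: let $\mathfrak g$ be a Leibniz algebra and $\mathfrak h$ a vector space regarded as an abelian algebra (zero bracket). A representation $(l,r)$ of $\mathfrak g$ on $\mathfrak h$ is a pair of linear maps $l,r:\mathfrak g\to\mathfrak{gl}(\mathfrak h)$ with $r_{[x,y]}=r_yr_x-r_xr_y$, $l_{[x,y]}=r_yl_x-l_xr_y$, $l_xl_y=-l_xr_y$ for all $x,y\in\mathfrak g$. A 2-cocycle with respect to $(l,r)$ is a bilinear map $\omega:\mathfrak g\times\mathfrak g\to\mathfrak h$ with $$\omega([x,y],z)-\omega(x,[y,z])-\omega([x,z],y)-l_x\omega(y,z)-r_y\omega(x,z)+r_z\omega(x,y)=0.$$ Then $\mathfrak g(\omega,l,r)$ denotes the Leibniz algebra $\mathfrak g\oplus\mathfrak h$ with bracket $[x+a,y+b]=[x,y]+\omega(x,y)+l_xb+r_ya$ ($x,y\in\mathfrak g$, $a,b\in\mathfrak h$). Here $\ker l=\{x\in\mathfrak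 g: l_x=0\}$, and similarly for $r$.
   Formalization: The extension is also assumed to be non-split (ω not a coboundary) and (l,r) not identically zero; otherwise the claim is false, e.g. ω=0, l=r=0 gives L_1⊕ℂ, which is not in the list. No extension so excluded is isomorphic to a listed algebra. *)

theory Defs
  imports "HOL-Analysis.Analysis"
begin

section \<open>Right Leibniz algebras over the complex numbers\<close>

definition bilinear_map ::
  "(complex \<Rightarrow> 'a \<Rightarrow> 'a) \<Rightarrow> (complex \<Rightarrow> 'b \<Rightarrow> 'b) \<Rightarrow> (complex \<Rightarrow> 'c \<Rightarrow> 'c)
    \<Rightarrow> ('a::ab_group_add \<Rightarrow> 'b::ab_group_add \<Rightarrow> 'c::ab_group_add) \<Rightarrow> bool" where
  "bilinear_map s1 s2 s3 B \<longleftrightarrow>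
     (\<forall>x. Vector_Spaces.linear s2 s3 (B x)) \<and> (\<forall>y. Vector_Spaces.linear s1 s3 (\<lambda>x. B x y))"

locale leibniz_algebra = vector_space scale
  for scale :: "complex \<Rightarrow> 'a::ab_group_add \<Rightarrow> 'a" +
  fixes br :: "'a \<Rightarrow> 'a \<Rightarrow> 'a"
  assumes bilinear_br: "bilinear_map scale scale scale br"
    and leibniz: "br (br x y) z = br x (br y z) + br (br x z) y"
begin

definition set_bracket :: "'a set \<Rightarrow> 'a set \<Rightarrow> 'a set" where
  "set_bracket A B = span {br a b | a b. a \<in> A \<and> b \<in> B}"

definition ideal :: "'a set \<Rightarrow> bool" where
  "ideal I \<longleftrightarrow> subspace I \<and> (\<forall>x\<in>I. \<forall>y. br x y \<in> I \<and> br y x \<in> I)"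

primrec lower_central :: "'a set \<Rightarrow> nat \<Rightarrow> 'a set" where
  "lower_central A 0 = A"
| "lower_central A (Suc n) = set_bracket (lower_central A n) A"

primrec derived :: "'a set \<Rightarrow> nat \<Rightarrow> 'a set" where
  "derived A 0 = A"
| "derived A (Suc n) = set_bracket (derived A n) (derived A n)"

definition nilpotent :: "'a set \<Rightarrow> bool" where
  "nilpotent A \<longleftrightarrow> (\<exists>n. lower_central A n = {0})"

definition solvable :: "'a set \<Rightarrow> bool" where
  "solvable A \<longleftrightarrow> (\<exists>n. derived A n = {0})"

definition is_nilradical :: "'a set \<Rightarrow> bool" where
  "is_nilradical N \<longleftrightarrow>
     ideal N \<and> nilpotent N \<and> (\<forall>I. ideal I \<longrightarrow> nilpotent I \<longrightarrow> I \<subseteq> N)"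

lemma set_bracket_subset:
  assumes "subspace S" "\<And>a b. a \<in> A \<Longrightarrow> b \<in> B \<Longrightarrow> br a b \<in> S"
  shows "set_bracket A B \<subseteq> S"
  unfolding set_bracket_def using assms by (intro span_minimal) auto

lemma not_nilpotent_ideal:
  assumes I: "ideal I" and v: "v \<in> I" and w: "br w v = scale c w" "c \<noteq> 0" "w \<noteq> 0"
  shows "\<not> nilpotent I"
proof -
  have sub: "subspace (lower_central I n)" for n
    using I by (cases n) (auto simp: ideal_def set_bracket_def)
  have w_in: "u \<in> A" if "subspace A" "scale c u \<in> A" for A u
    using subspace_scale[OF that, of "inverse c"] w(2) by simp
  have "w \<in> lower_central I n" for n
  proof (induction n)
    case 0
    have "br w v \<in> I" using I v by (auto simp: ideal_def)
    then show ?case using w_in[OF sub[of 0]] w(1) by simp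
  next
    case (Suc n)
    have "br w v \<in> lower_central I (Suc n)"
      using Suc v by (auto simp: set_bracket_def intro!: span_base)
    then show ?case using w_in[OF sub[of "Suc n"]] w(1) by metis
  qed
  then show ?thesis using w(3) by (auto simp: nilpotent_def)
qed

end

definition isomorphic_algebras ::
  "(complex \<Rightarrow> 'a::ab_group_add \<Rightarrow> 'a) \<Rightarrow> ('a \<Rightarrow> 'a \<Rightarrow> 'a) \<Rightarrow> (complex \<Rightarrow> 'b::ab_group_add \<Rightarrow> 'b) \<Rightarrow> ('b \<Rightarrow> 'b \<Rightarrow> 'b)
    \<Rightarrow> bool" where
  "isomorphic_algebras s1 br1 s2 br2 \<longleftrightarrow>
     (\<exists>\<phi>. Vector_Spaces.linear s1 s2 \<phi> \<and> bij \<phi> \<and>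
       (\<forall>x y. \<phi> (br1 x y) = br2 (\<phi> x) (\<phi> y)))"

section \<open>Abelian extensions\<close>

locale leibniz_representation =
  leibniz_algebra sg br + h: vector_space sh
  for sg :: "complex \<Rightarrow> 'g::ab_group_add \<Rightarrow> 'g" and br
    and sh :: "complex \<Rightarrow> 'h::ab_group_add \<Rightarrow> 'h" +
  fixes l r :: "'g \<Rightarrow> 'h \<Rightarrow> 'h"
  assumes bilinear_l: "bilinear_map sg sh sh l"
    and bilinear_r: "bilinear_map sg sh sh r"
    and r_br: "r (br x y) a = r y (r x a) - r x (r y a)"
    and l_br: "l (br x y) a = r y (l x a) - l x (r y a)"
    and l_l: "l x (l y a) = - l x (r y a)"

definition rep_kernel :: "('g \<Rightarrow> 'h \<Rightarrow> 'h::zero) \<Rightarrow> 'g set" where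
  "rep_kernel f = {x. f x = (\<lambda>_. 0)}"

locale leibniz_cocycle = leibniz_representation sg br sh l r
  for sg :: "complex \<Rightarrow> 'g::ab_group_add \<Rightarrow> 'g" and br
    and sh :: "complex \<Rightarrow> 'h::ab_group_add \<Rightarrow> 'h" and l r +
  fixes \<omega> :: "'g \<Rightarrow> 'g \<Rightarrow> 'h"
  assumes bilinear_\<omega>: "bilinear_map sg sg sh \<omega>"
    and cocycle: "\<omega> (br x y) z - \<omega> x (br y z) - \<omega> (br x z) y
      - l x (\<omega> y z) - r y (\<omega> x z) + r z (\<omega> x y) = 0"

definition abelian_extension ::
  "('g \<Rightarrow> 'g \<Rightarrow> 'g) \<Rightarrow> ('g \<Rightarrow> 'g \<Rightarrow> 'h) \<Rightarrow> ('g \<Rightarrow> 'h \<Rightarrow> 'h) \<Rightarrow> ('g \<Rightarrow> 'h \<Rightarrow> 'h)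
    \<Rightarrow> 'g \<times> 'h \<Rightarrow> 'g \<times> 'h \<Rightarrow> 'g \<times> 'h::ab_group_add" where
  "abelian_extension br \<omega> l r =
     (\<lambda>(x, a) (y, b). (br x y, \<omega> x y + l x b + r y a))"

text \<open>The extension splits if the projection onto the first summand has a section that is a
  homomorphism of Leibniz algebras.\<close>

definition split_extension ::
  "(complex \<Rightarrow> 'g \<Rightarrow> 'g) \<Rightarrow> ('g \<Rightarrow> 'g \<Rightarrow> 'g) \<Rightarrow> (complex \<Rightarrow> 'h \<Rightarrow> 'h)
    \<Rightarrow> ('g::ab_group_add \<Rightarrow> 'g \<Rightarrow> 'h::ab_group_add) \<Rightarrow> ('g \<Rightarrow> 'h \<Rightarrow> 'h) \<Rightarrow> ('g \<Rightarrow> 'h \<Rightarrow> 'h) \<Rightarrow> bool" where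
  "split_extension sg br sh \<omega> l r \<longleftrightarrow>
     (\<exists>\<sigma>. Vector_Spaces.linear sg (module_prod.scale sg sh) \<sigma> \<and> (\<forall>x. fst (\<sigma> x) = x) \<and>
       (\<forall>x y. \<sigma> (br x y) = abelian_extension br \<omega> l r (\<sigma> x) (\<sigma> y)))"

lemma (in leibniz_cocycle) leibniz_algebra_abelian_extension:
  "leibniz_algebra (module_prod.scale sg sh) (abelian_extension br \<omega> l r)"
proof -
  interpret P: vector_space_prod sg sh ..
  have lin: "Vector_Spaces.linear sg sg (br x)" "Vector_Spaces.linear sg sg (\<lambda>x. br x y)"
      "Vector_Spaces.linear sh sh (l x)" "Vector_Spaces.linear sg sh (\<lambda>x. l x a)"
      "Vector_Spaces.linear sh sh (r x)" "Vector_Spaces.linear sg sh (\<lambda>x. r x a)"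
      "Vector_Spaces.linear sg sh (\<omega> x)" "Vector_Spaces.linear sg sh (\<lambda>x. \<omega> x y)" for x y a
    using bilinear_br bilinear_l bilinear_r bilinear_\<omega> by (auto simp: bilinear_map_def)
  note hom = lin[unfolded Vector_Spaces.linear_iff, THEN conjunct2, THEN conjunct2]
  note add = hom[THEN conjunct1, rule_format] and sc = hom[THEN conjunct2, rule_format]
  have bil: "bilinear_map P.scale P.scale P.scale (abelian_extension br \<omega> l r)"
    unfolding bilinear_map_def Vector_Spaces.linear_iff
    by (auto simp: abelian_extension_def P.scale_def add sc scale_right_distrib
        h.scale_right_distrib P.p.vector_space_axioms)
  show ?thesis
  proof (unfold_locales, fact bil)
    fix u v w :: "'g \<times> 'h"
    obtain x a y b z c where uvw: "u = (x, a)" "v = (y, b)" "w = (z, c)"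
      by (metis surj_pair)
    have \<omega>: "\<omega> (br x y) z = \<omega> x (br y z) + \<omega> (br x z) y
        + l x (\<omega> y z) + r y (\<omega> x z) - r z (\<omega> x y)"
      using cocycle[of x y z] by (simp add: algebra_simps)
    show "abelian_extension br \<omega> l r (abelian_extension br \<omega> l r u v) w =
        abelian_extension br \<omega> l r u (abelian_extension br \<omega> l r v w) +
        abelian_extension br \<omega> l r (abelian_extension br \<omega> l r u w) v"
      unfolding uvw abelian_extension_def prod.case
      by (simp only: add leibniz[of x y z] r_br l_br l_l \<omega> add_Pair prod.inject)
        (simp add: algebra_simps)
  qed
qed

section \<open>Algebras given by products of basis elements\<close>

abbreviation basis_vec :: "'b \<Rightarrow> complex ^ 'b" where
  "basis_vec i \<equiv> axis i 1"

definition table_bracket ::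
  "('b \<times> 'b \<Rightarrow> complex ^ 'b) \<Rightarrow> complex ^ 'b \<Rightarrow> complex ^ 'b \<Rightarrow> complex ^ 'b" where
  "table_bracket T x y = (\<Sum>i\<in>UNIV. \<Sum>j\<in>UNIV. (x $ i * y $ j) *s T (i, j))"

lemma bilinear_table_bracket: "bilinear_map (*s) (*s) (*s) (table_bracket T)"
  unfolding bilinear_map_def Vector_Spaces.linear_iff table_bracket_def
  by (auto simp: vec.vector_space_axioms algebra_simps sum.distrib vec.scale_sum_right
      vector_add_ldistrib vec.scale_left_distrib)

section \<open>The algebra \<open>L\<^sub>1\<close> and the six-dimensional algebras\<close>

text \<open>The products of \<open>L\<^sub>1\<close> relative to five indices of a possibly larger basis.\<close>

definition L1_products :: "'b \<Rightarrow> 'b \<Rightarrow> 'b \<Rightarrow> 'b \<Rightarrow> 'b \<Rightarrow> 'b \<times> 'b \<Rightarrow> complex ^ 'b" where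
  "L1_products e1 e2 e3 x1 x2 = (\<lambda>_. 0)
     ((e2, e1) := basis_vec e3,
      (e1, x1) := basis_vec e1,
      (x1, e1) := - basis_vec e1,
      (e3, x1) := basis_vec e3,
      (e2, x2) := basis_vec e2,
      (e3, x2) := basis_vec e3)"

datatype idx5 = E1 | E2 | E3 | X1 | X2

lemma UNIV_idx5: "UNIV = {E1, E2, E3, X1, X2}" (is "_ = ?A")
proof -
  have "x \<in> ?A" for x by (cases x) auto
  then show ?thesis by blast
qed

instance idx5 :: finite
  by standard (simp add: UNIV_idx5)

lemma sum_idx5: "(\<Sum>i\<in>UNIV. f i) = f E1 + f E2 + f E3 + f X1 + f X2"
  for f :: "idx5 \<Rightarrow> 'a::comm_monoid_add"
  by (simp add: UNIV_idx5 add_ac)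

definition L1_bracket :: "complex ^ idx5 \<Rightarrow> complex ^ idx5 \<Rightarrow> complex ^ idx5" where
  "L1_bracket = table_bracket (L1_products E1 E2 E3 X1 X2)"

definition L1_N :: "(complex ^ idx5) set" where
  "L1_N = vec.span {basis_vec E1, basis_vec E2, basis_vec E3}"

lemma L1_bracket_nth [simp]:
  "L1_bracket x y $ E1 = x $ E1 * y $ X1 - x $ X1 * y $ E1"
  "L1_bracket x y $ E2 = x $ E2 * y $ X2"
  "L1_bracket x y $ E3 = x $ E2 * y $ E1 + x $ E3 * y $ X1 + x $ E3 * y $ X2"
  "L1_bracket x y $ X1 = 0"
  "L1_bracket x y $ X2 = 0"
  by (simp_all add: L1_bracket_def table_bracket_def sum_idx5,
      simp_all add: L1_products_def, simp_all add: axis_def)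

lemma vec_eq_idx5:
  "u = v \<longleftrightarrow> u $ E1 = v $ E1 \<and> u $ E2 = v $ E2 \<and> u $ E3 = v $ E3 \<and> u $ X1 = v $ X1 \<and> u $ X2 = v $ X2"
  for u v :: "complex ^ idx5"
proof (rule iffI, simp, rule vec_eq_iff[THEN iffD2], rule allI)
  fix i
  assume "u $ E1 = v $ E1 \<and> u $ E2 = v $ E2 \<and> u $ E3 = v $ E3 \<and> u $ X1 = v $ X1 \<and> u $ X2 = v $ X2"
  then show "u $ i = v $ i" by (cases i) simp_all
qed

interpretation L1: leibniz_algebra "(*s)" L1_bracket
proof unfold_locales
  show "bilinear_map (*s) (*s) (*s) L1_bracket"
    by (simp add: L1_bracket_def bilinear_table_bracket)
  show "L1_bracket (L1_bracket x y) z = L1_bracket x (L1_bracket y z) + L1_bracket (L1_bracket x z) y"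
    for x y z
    unfolding vec_eq_idx5 by (intro conjI) (simp_all only: L1_bracket_nth vector_add_component,
      simp_all add: algebra_simps)
qed

lemma mem_L1_N: "x \<in> L1_N \<longleftrightarrow> x $ X1 = 0 \<and> x $ X2 = 0"
proof
  have sub: "vec.subspace {x :: complex ^ idx5. x $ X1 = 0 \<and> x $ X2 = 0}"
    by (simp add: vec.subspace_def)
  have "L1_N \<subseteq> {x. x $ X1 = 0 \<and> x $ X2 = 0}"
    unfolding L1_N_def by (rule vec.span_minimal[OF _ sub]) (auto simp: axis_def)
  then show "x \<in> L1_N \<Longrightarrow> x $ X1 = 0 \<and> x $ X2 = 0" by blast
next
  assume "x $ X1 = 0 \<and> x $ X2 = 0"
  then have "x = x $ E1 *s basis_vec E1 + x $ E2 *s basis_vec E2 + x $ E3 *s basis_vec E3"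
    by (simp add: vec_eq_idx5 axis_def)
  moreover have "\<dots> \<in> L1_N"
    unfolding L1_N_def by (intro vec.span_add vec.span_scale vec.span_base) auto
  ultimately show "x \<in> L1_N" by simp
qed

lemma subspace_idx5:
  "vec.subspace {x :: complex ^ idx5. x $ X1 = 0 \<and> x $ X2 = 0 \<and> x $ E1 = 0 \<and> x $ E2 = 0}"
  by (simp add: vec.subspace_def)

lemma zero_mem_set_bracket: "0 \<in> L1.set_bracket A B"
  by (simp add: L1.set_bracket_def vec.span_zero)

lemma L1_solvable: "L1.solvable UNIV"
proof -
  have "L1.derived UNIV 1 \<subseteq> L1_N"
    unfolding One_nat_def L1.derived.simps
    by (rule L1.set_bracket_subset) (simp_all add: mem_L1_N, simp add: L1_N_def)
  then have 1: "a $ X1 = 0 \<and> a $ X2 = 0" if "a \<in> L1.derived UNIV 1" for a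
    using that mem_L1_N by blast
  have 2: "L1.derived UNIV 2 \<subseteq> {x. x $ X1 = 0 \<and> x $ X2 = 0 \<and> x $ E1 = 0 \<and> x $ E2 = 0}"
    unfolding numeral_2_eq_2 L1.derived.simps(2)[of UNIV "Suc 0"]
    by (rule L1.set_bracket_subset[OF subspace_idx5]) (use 1 in simp)
  have "L1.derived UNIV 3 \<subseteq> {0}"
    unfolding numeral_3_eq_3 L1.derived.simps(2)[of UNIV "Suc (Suc 0)"]
  proof (rule L1.set_bracket_subset[OF vec.subspace_single_0])
    fix a b assume "a \<in> L1.derived UNIV (Suc (Suc 0))" "b \<in> L1.derived UNIV (Suc (Suc 0))"
    then show "L1_bracket a b \<in> {0}"
      using 2 unfolding numeral_2_eq_2 by (auto simp: vec_eq_idx5 simp del: L1.derived.simps)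
  qed
  then have "L1.derived UNIV 3 = {0}"
    using zero_mem_set_bracket by (auto simp: numeral_3_eq_3)
  then show ?thesis by (auto simp: L1.solvable_def)
qed

lemma L1_nilradical: "L1.is_nilradical L1_N"
  unfolding L1.is_nilradical_def
proof (intro conjI allI impI)
  show "L1.ideal L1_N"
    by (simp add: L1.ideal_def mem_L1_N) (simp add: L1_N_def)
  have 1: "L1.lower_central L1_N 1 \<subseteq> {x. x $ X1 = 0 \<and> x $ X2 = 0 \<and> x $ E1 = 0 \<and> x $ E2 = 0}"
    unfolding One_nat_def L1.lower_central.simps
    by (intro L1.set_bracket_subset subspace_idx5) (simp add: mem_L1_N)
  have "L1.lower_central L1_N 2 \<subseteq> {0}"
    unfolding numeral_2_eq_2 L1.lower_central.simps(2)[of L1_N "Suc 0"]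
    using 1 by (intro L1.set_bracket_subset vec.subspace_single_0)
      (auto simp: vec_eq_idx5 mem_L1_N simp del: L1.lower_central.simps dest!: subsetD)
  then have "L1.lower_central L1_N 2 = {0}"
    using zero_mem_set_bracket by (auto simp: numeral_2_eq_2)
  then show "L1.nilpotent L1_N" by (auto simp: L1.nilpotent_def)
next
  fix I assume I: "L1.ideal I" "L1.nilpotent I"
  show "I \<subseteq> L1_N"
  proof
    fix v assume v: "v \<in> I"
    have "L1_bracket (basis_vec E1) v = v $ X1 *s basis_vec E1"
      by (simp add: vec_eq_idx5 axis_def)
    then have 1: "v $ X1 = 0"
      using L1.not_nilpotent_ideal[OF I(1) v] I(2) by (metis axis_eq_0_iff zero_neq_one)
    then have "L1_bracket (basis_vec E3) v = v $ X2 *s basis_vec E3"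
      by (simp add: vec_eq_idx5 axis_def)
    then have "v $ X2 = 0"
      using L1.not_nilpotent_ideal[OF I(1) v] I(2) by (metis axis_eq_0_iff zero_neq_one)
    with 1 show "v \<in> L1_N" by (simp add: mem_L1_N)
  qed
qed

datatype idx6 = E1 | E2 | E3 | E4 | X1 | X2

lemma UNIV_idx6: "UNIV = {E1, E2, E3, E4, X1, X2}" (is "_ = ?A")
proof -
  have "x \<in> ?A" for x by (cases x) auto
  then show ?thesis by blast
qed

instance idx6 :: finite
  by standard (simp add: UNIV_idx6)

datatype label = A1 | A2 | A3 | A4 | A5 complex | A6 | A7 complex

primrec Lhat1_products :: "label \<Rightarrow> idx6 \<times> idx6 \<Rightarrow> complex ^ idx6" where
  "Lhat1_products A1 = (L1_products E1 E2 E3 X1 X2)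
     ((X2, E1) := basis_vec E4,
      (E4, X1) := basis_vec E4)"
| "Lhat1_products A2 = (L1_products E1 E2 E3 X1 X2)
     ((E1, E1) := basis_vec E4,
      (E4, X1) := 2 *s basis_vec E4)"
| "Lhat1_products A3 = (L1_products E1 E2 E3 X1 X2)
     ((E3, E1) := basis_vec E4,
      (E4, X1) := 2 *s basis_vec E4,
      (E4, X2) := basis_vec E4)"
| "Lhat1_products A4 = (L1_products E1 E2 E3 X1 X2)
     ((E2, X1) := basis_vec E4,
      (E4, X2) := basis_vec E4)"
| "Lhat1_products (A5 \<delta>) = (L1_products E1 E2 E3 X1 X2)
     ((E2, X2) := basis_vec E2 + basis_vec E4,
      (E2, X1) := \<delta> *s basis_vec E4,
      (E4, X2) := basis_vec E4)"
| "Lhat1_products A6 = (L1_products E1 E2 E3 X1 X2)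
     ((E1, X1) := basis_vec E1 + basis_vec E4,
      (X1, E1) := - basis_vec E1 - basis_vec E4,
      (E4, X1) := basis_vec E4,
      (X1, E4) := - basis_vec E4)"
| "Lhat1_products (A7 \<delta>) = (L1_products E1 E2 E3 X1 X2)
     ((E1, X1) := basis_vec E1 + \<delta> *s basis_vec E4,
      (X1, E1) := - basis_vec E1 - \<delta> *s basis_vec E4,
      (E1, X2) := basis_vec E4,
      (X2, E1) := - basis_vec E4,
      (E4, X1) := basis_vec E4,
      (X1, E4) := - basis_vec E4)"

definition Lhat1_bracket :: "label \<Rightarrow> complex ^ idx6 \<Rightarrow> complex ^ idx6 \<Rightarrow> complex ^ idx6" where
  "Lhat1_bracket k = table_bracket (Lhat1_products k)"

lemma sum_idx6: "(\<Sum>i\<in>UNIV. f i) = f E1 + f E2 + f E3 + f E4 + f X1 + f X2"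
  for f :: "idx6 \<Rightarrow> 'a::comm_monoid_add"
  by (simp add: UNIV_idx6 add_ac)

lemma vec_eq_idx6:
  "u = v \<longleftrightarrow> u $ E1 = v $ E1 \<and> u $ E2 = v $ E2 \<and> u $ E3 = v $ E3 \<and> u $ E4 = v $ E4 \<and>
    u $ X1 = v $ X1 \<and> u $ X2 = v $ X2"
  for u v :: "complex ^ idx6"
proof (rule iffI, simp, rule vec_eq_iff[THEN iffD2], rule allI)
  fix i
  assume "u $ E1 = v $ E1 \<and> u $ E2 = v $ E2 \<and> u $ E3 = v $ E3 \<and> u $ E4 = v $ E4 \<and> u $ X1 = v $ X1 \<and> u $ X2 = v $ X2"
  then show "u $ i = v $ i" by (cases i) simp_all
qed

lemma Lhat1_bracket_nth:
  "Lhat1_bracket k x y $ E1 = x $ E1 * y $ X1 - x $ X1 * y $ E1"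
  "Lhat1_bracket k x y $ E2 = x $ E2 * y $ X2"
  "Lhat1_bracket k x y $ E3 = x $ E2 * y $ E1 + x $ E3 * y $ X1 + x $ E3 * y $ X2"
  "Lhat1_bracket k x y $ X1 = 0"
  "Lhat1_bracket k x y $ X2 = 0"
  "Lhat1_bracket k x y $ E4 = (case k of
     A1 \<Rightarrow> x $ X2 * y $ E1 + x $ E4 * y $ X1
   | A2 \<Rightarrow> x $ E1 * y $ E1 + 2 * x $ E4 * y $ X1
   | A3 \<Rightarrow> x $ E3 * y $ E1 + 2 * x $ E4 * y $ X1 + x $ E4 * y $ X2
   | A4 \<Rightarrow> x $ E2 * y $ X1 + x $ E4 * y $ X2
   | A5 \<delta> \<Rightarrow> x $ E2 * y $ X2 + \<delta> * x $ E2 * y $ X1 + x $ E4 * y $ X2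
   | A6 \<Rightarrow> x $ E1 * y $ X1 - x $ X1 * y $ E1 + x $ E4 * y $ X1 - x $ X1 * y $ E4
   | A7 \<delta> \<Rightarrow> \<delta> * (x $ E1 * y $ X1 - x $ X1 * y $ E1) + x $ E1 * y $ X2 - x $ X2 * y $ E1
        + x $ E4 * y $ X1 - x $ X1 * y $ E4)"
  by (simp_all only: Lhat1_bracket_def table_bracket_def sum_idx6)
    (cases k; simp add: L1_products_def; simp add: axis_def; simp add: algebra_simps)+

lemma leibniz_algebra_Lhat1: "leibniz_algebra (*s) (Lhat1_bracket k)"
proof unfold_locales
  show "bilinear_map (*s) (*s) (*s) (Lhat1_bracket k)"
    by (simp add: Lhat1_bracket_def bilinear_table_bracket)
  show "Lhat1_bracket k (Lhat1_bracket k x y) z =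
      Lhat1_bracket k x (Lhat1_bracket k y z) + Lhat1_bracket k (Lhat1_bracket k x z) y" for x y z
    unfolding vec_eq_idx6
    by (cases k) (simp_all add: Lhat1_bracket_nth, simp_all add: algebra_simps)
qed

end

theory Submission
  imports Defs
begin

text \<open>Since \<open>h\<close> is a line on which the nilradical acts trivially, the representation is a pair of linear
  forms \<open>\<mu>\<close> (left) and \<open>\<rho>\<close> (right) vanishing on \<open>N\<close>; the relation \<open>\<mu> x * (\<mu> y + \<rho> y) = 0\<close> leaves the
  two cases \<open>\<mu> = 0\<close> and \<open>\<mu> = - \<rho>\<close>. In each case a cocycle is normalised by a coboundary, after which
  almost all of its 25 entries vanish, and the remaining ones force \<open>\<rho>\<close> to be one of the few weights
  occurring in the list. Rescaling \<open>e4\<close> gives the normal form.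

  Conversely, the traces of left and right multiplications and of products of two right
  multiplications are isomorphism invariants. They force an isomorphism to preserve the \<open>x1\<close>- and
  \<open>x2\<close>-coordinates of \<open>x1\<close> and \<open>x2\<close> and the weight of \<open>e4\<close>. What remains is to compare \<open>A4\<close> with
  \<open>A5\<close> and \<open>A6\<close> with \<open>A7\<close>, which are told apart by the ratio of the nilpotent parts of \<open>x1\<close> and
  \<open>x2\<close> on a two-dimensional weight space.\<close>

section \<open>Classification of the extensions\<close>


lemma L1_bracket_basis:
  "L1_bracket (basis_vec i) (basis_vec j) = L1_products idx5.E1 idx5.E2 idx5.E3 idx5.X1 idx5.X2 (i, j)"
  by (cases i; cases j) (simp_all add: vec_eq_idx5, simp_all add: L1_products_def axis_def)

lemma vec_idx5_expansion:
  "x = x $ idx5.E1 *s basis_vec idx5.E1 + x $ idx5.E2 *s basis_vec idx5.E2 + x $ idx5.E3 *s basis_vec idx5.E3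
    + x $ idx5.X1 *s basis_vec idx5.X1 + x $ idx5.X2 *s basis_vec idx5.X2" for x :: "complex ^ idx5"
  by (simp add: vec_eq_idx5 axis_def)

text \<open>Replacing the coordinate \<open>a\<close> on the line by \<open>a + g x\<close> changes
  a cocycle by minus this term.\<close>

definition scalar_coboundary ::
  "(complex ^ idx5 \<Rightarrow> complex) \<Rightarrow> (complex ^ idx5 \<Rightarrow> complex) \<Rightarrow> (complex ^ idx5 \<Rightarrow> complex)
    \<Rightarrow> complex ^ idx5 \<Rightarrow> complex ^ idx5 \<Rightarrow> complex" where
  "scalar_coboundary \<mu> \<rho> g x y = \<mu> x * g y + \<rho> y * g x - g (L1_bracket x y)"

lemma linear_form_iff:
  "Vector_Spaces.linear (*s) (*) f \<longleftrightarrow> (\<forall>x y. f (x + y) = f x + f y) \<and> (\<forall>c x. f (c *s x) = c * f x)"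
  for f :: "'a::field ^ 'n \<Rightarrow> 'a"
proof -
  have "vector_space ((*) :: 'a \<Rightarrow> 'a \<Rightarrow> 'a)"
    by unfold_locales (simp_all add: algebra_simps)
  then show ?thesis
    by (simp add: Vector_Spaces.linear_iff vec.vector_space_axioms)
qed

lemma linear_form_exists:
  fixes c :: "'n::finite \<Rightarrow> 'a::field"
  obtains g where "Vector_Spaces.linear (*s) (*) g" "\<And>i. g (axis i 1) = c i"
proof (rule that)
  show "Vector_Spaces.linear (*s) (*) (\<lambda>x. \<Sum>i\<in>UNIV. c i * x $ i)"
    by (simp add: linear_form_iff sum.distrib sum_distrib_left algebra_simps)
  show "(\<Sum>j\<in>UNIV. c j * axis i 1 $ j) = c i" for i
    by (simp add: axis_def if_distrib cong: if_cong)
qed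

definition lift :: "complex ^ idx5 \<Rightarrow> complex \<Rightarrow> complex ^ idx6" where
  "lift x s = (\<chi> i. case i of E1 \<Rightarrow> x $ idx5.E1 | E2 \<Rightarrow> x $ idx5.E2 | E3 \<Rightarrow> x $ idx5.E3 | E4 \<Rightarrow> s
    | X1 \<Rightarrow> x $ idx5.X1 | X2 \<Rightarrow> x $ idx5.X2)"

lemma lift_nth [simp]:
  "lift x s $ E1 = x $ idx5.E1" "lift x s $ E2 = x $ idx5.E2" "lift x s $ E3 = x $ idx5.E3"
  "lift x s $ E4 = s" "lift x s $ X1 = x $ idx5.X1" "lift x s $ X2 = x $ idx5.X2"
  by (simp_all add: lift_def)

text \<open>Cocycle data for a one-dimensional \<open>h\<close>, written in a coordinate. Scalars
  commute, so the relations for \<open>r\<close> and \<open>l\<close> of a bracket only say that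
  both forms vanish on brackets, which lie in \<open>L1_N\<close>; the third relation is
  \<open>\<mu>_\<mu>\<close>.\<close>

locale L1_scalar_cocycle =
  fixes \<mu> \<rho> :: "complex ^ idx5 \<Rightarrow> complex" and W :: "complex ^ idx5 \<Rightarrow> complex ^ idx5 \<Rightarrow> complex"
  assumes linear_\<mu>: "Vector_Spaces.linear (*s) (*) \<mu>" and linear_\<rho>: "Vector_Spaces.linear (*s) (*) \<rho>"
    and bilinear_W: "bilinear_map (*s) (*s) (*) W"
    and \<mu>_N: "x \<in> L1_N \<Longrightarrow> \<mu> x = 0" and \<rho>_N: "x \<in> L1_N \<Longrightarrow> \<rho> x = 0"
    and \<mu>_\<mu>: "\<mu> x * \<mu> y = - \<mu> x * \<rho> y"
    and cocycle: "W (L1_bracket x y) z - W x (L1_bracket y z) - W (L1_bracket x z) y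
      - \<mu> x * W y z - \<rho> y * W x z + \<rho> z * W x y = 0"
begin

abbreviation "e1 \<equiv> basis_vec idx5.E1"
abbreviation "e2 \<equiv> basis_vec idx5.E2"
abbreviation "e3 \<equiv> basis_vec idx5.E3"
abbreviation "x1 \<equiv> basis_vec idx5.X1"
abbreviation "x2 \<equiv> basis_vec idx5.X2"

lemma W_linear:
  "W (x + x') y = W x y + W x' y" "W (c *s x) y = c * W x y"
  "W x (y + y') = W x y + W x y'" "W x (c *s y) = c * W x y"
  using bilinear_W by (auto simp: bilinear_map_def linear_form_iff)

lemma W_zero [simp]: "W 0 y = 0" "W x 0 = 0"
  using W_linear(2)[of 0 0 y] W_linear(4)[of x 0 0] by simp_all

lemma W_minus [simp]: "W (- x) y = - W x y" "W x (- y) = - W x y"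
  using W_linear(1)[of x "- x" y] W_linear(3)[of x y "- y"] by (simp_all add: eq_neg_iff_add_eq_0 add.commute)

lemma \<mu>_linear: "\<mu> (x + y) = \<mu> x + \<mu> y" "\<mu> (c *s x) = c * \<mu> x"
  and \<rho>_linear: "\<rho> (x + y) = \<rho> x + \<rho> y" "\<rho> (c *s x) = c * \<rho> x"
  using linear_\<mu> linear_\<rho> by (auto simp: linear_form_iff)

lemma \<mu>_\<rho>_basis [simp]:
  "\<mu> e1 = 0" "\<mu> e2 = 0" "\<mu> e3 = 0" "\<rho> e1 = 0" "\<rho> e2 = 0" "\<rho> e3 = 0"
  by (auto intro!: \<mu>_N \<rho>_N simp: mem_L1_N axis_def)

lemma \<mu>_\<rho>_bracket [simp]: "\<mu> (L1_bracket x y) = 0" "\<rho> (L1_bracket x y) = 0"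
  by (auto intro!: \<mu>_N \<rho>_N simp: mem_L1_N)

lemma \<mu>_\<rho>_expansion:
  "\<mu> x = x $ idx5.X1 * \<mu> x1 + x $ idx5.X2 * \<mu> x2" "\<rho> x = x $ idx5.X1 * \<rho> x1 + x $ idx5.X2 * \<rho> x2"
  by (subst vec_idx5_expansion[of x], simp add: \<mu>_linear \<rho>_linear)+

lemma W_expansion: "W x y = (\<Sum>i\<in>UNIV. \<Sum>j\<in>UNIV. x $ i * y $ j * W (basis_vec i) (basis_vec j))"
  by (subst vec_idx5_expansion[of x], subst vec_idx5_expansion[of y])
    (simp add: W_linear sum_idx5 algebra_simps)

text \<open>Adding the cocycle identities for \<open>(x, y, z)\<close> and \<open>(x, z, y)\<close>
  cancels all other terms. It is useful because \<open>e3\<close> and \<open>e2\<close> are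
  symmetrised brackets, of \<open>e2\<close> with \<open>e1\<close> and with
  \<open>x2\<close>.\<close>

lemma cocycle_sym:
  "W x (L1_bracket y z + L1_bracket z y) = - \<mu> x * (W y z + W z y)"
  using cocycle[of x y z] cocycle[of x z y] unfolding W_linear by algebra

text \<open>A coboundary is a cocycle: the Leibniz identity handles \<open>g\<close> of double
  brackets, and \<open>\<mu>_\<mu>\<close> the products of two forms that do not cancel
  directly.\<close>

lemma diff_coboundary:
  assumes "Vector_Spaces.linear (*s) (*) g"
  shows "L1_scalar_cocycle \<mu> \<rho> (\<lambda>x y. W x y - scalar_coboundary \<mu> \<rho> g x y)"
proof -
  have g: "g (x + y) = g x + g y" "g (c *s x) = c * g x" for x y c
    using assms by (auto simp: linear_form_iff)
  have add: "L1_bracket (x + x') y = L1_bracket x y + L1_bracket x' y"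
    "L1_bracket x (y + y') = L1_bracket x y + L1_bracket x y'"
    and scale: "L1_bracket (c *s x) y = c *s L1_bracket x y"
    "L1_bracket x (c *s y) = c *s L1_bracket x y" for x x' y y' c
    by (simp_all add: vec_eq_idx5 algebra_simps)
  show ?thesis
  proof (rule L1_scalar_cocycle.intro)
    show "bilinear_map (*s) (*s) (*) (\<lambda>x y. W x y - scalar_coboundary \<mu> \<rho> g x y)"
      unfolding bilinear_map_def linear_form_iff scalar_coboundary_def
      by (simp add: add scale g W_linear \<mu>_linear \<rho>_linear algebra_simps)
  next
    fix x y z
    have "g (L1_bracket (L1_bracket x y) z) = g (L1_bracket x (L1_bracket y z)) + g (L1_bracket (L1_bracket x z) y)"
      by (simp flip: g add: L1.leibniz[of x y z])
    moreover note cocycle[of x y z]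
    moreover have "\<mu> x * (\<mu> y * g z) = - (\<mu> x * (\<rho> y * g z))"
      using \<mu>_\<mu>[of x y] by (metis mult.assoc mult_minus_left)
    ultimately show "W (L1_bracket x y) z - scalar_coboundary \<mu> \<rho> g (L1_bracket x y) z -
       (W x (L1_bracket y z) - scalar_coboundary \<mu> \<rho> g x (L1_bracket y z)) -
       (W (L1_bracket x z) y - scalar_coboundary \<mu> \<rho> g (L1_bracket x z) y) -
       \<mu> x * (W y z - scalar_coboundary \<mu> \<rho> g y z) - \<rho> y * (W x z - scalar_coboundary \<mu> \<rho> g x z) +
       \<rho> z * (W x y - scalar_coboundary \<mu> \<rho> g x y) = 0"
      unfolding scalar_coboundary_def \<mu>_\<rho>_bracket
      by (simp add: algebra_simps)
  qed (fact linear_\<mu> linear_\<rho> \<mu>_N \<rho>_N \<mu>_\<mu>)+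
qed

section \<open>Normal forms of scalar cocycles\<close>

lemmas basis_bracket = L1_bracket_basis L1_products_def

text \<open>The case \<open>\<mu> = 0\<close>. The assumed zeros are those that a coboundary can
  arrange. They spread by the cocycle identity, and the surviving entries obey weight equations
  under \<open>x1\<close> and \<open>x2\<close>.\<close>

lemma right_normalized:
  assumes \<mu>0: "\<And>x. \<mu> x = 0"
    and z: "z = x1 \<or> z = x2" "\<rho> z \<noteq> 0" "W x1 z = 0" "W x2 z = 0"
    and e: "W e2 e1 = 0" "W x1 e1 = 0"
    and e2_x1: "\<rho> x1 \<noteq> 0 \<longrightarrow> W e2 x1 = 0"
    and e2_x2: "\<rho> x1 = 0 \<and> \<rho> x2 \<noteq> 1 \<longrightarrow> W e2 x2 = 0"
  shows "W x y = W x2 e1 * (x $ idx5.X2 * y $ idx5.E1) + W e1 e1 * (x $ idx5.E1 * y $ idx5.E1)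
      + W e3 e1 * (x $ idx5.E3 * y $ idx5.E1)
      + x $ idx5.E2 * (W e2 x1 * y $ idx5.X1 + W e2 x2 * y $ idx5.X2)"
    and "W x2 e1 \<noteq> 0 \<Longrightarrow> \<rho> x1 = 1 \<and> \<rho> x2 = 0"
    and "W e1 e1 \<noteq> 0 \<Longrightarrow> \<rho> x1 = 2 \<and> \<rho> x2 = 0"
    and "W e3 e1 \<noteq> 0 \<Longrightarrow> \<rho> x1 = 2 \<and> \<rho> x2 = 1"
    and "W e2 x1 \<noteq> 0 \<or> W e2 x2 \<noteq> 0 \<Longrightarrow> \<rho> x1 = 0 \<and> \<rho> x2 = 1"
proof -
  note c = cocycle[unfolded \<mu>0]
  have e2: "W x e2 = 0" for x
    using cocycle_sym[of x e2 x2] by (simp add: \<mu>0 basis_bracket)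
  have e3: "W x e3 = 0" for x
    using cocycle_sym[of x e2 e1] by (simp add: \<mu>0 basis_bracket)
  \<comment> \<open>The identity for \<open>(u, z, v)\<close> reduces to
    \<open>\<rho> z * W u v = 0\<close>.\<close>
  have xx: "W u v = 0" if "u = x1 \<or> u = x2" "v = x1 \<or> v = x2" for u v
    using c[of u z v] that z by (auto simp: basis_bracket)
  have e1x: "W e1 x1 = 0" "W e1 x2 = 0"
    using c[of x1 e1 x1] c[of x1 e1 x2] e by (simp_all add: basis_bracket)
  have e3x: "W e3 x1 = 0" "W e3 x2 = 0"
    using c[of e2 e1 x1] c[of e2 e1 x2] e by (simp_all add: basis_bracket)
  show "W x y = W x2 e1 * (x $ idx5.X2 * y $ idx5.E1) + W e1 e1 * (x $ idx5.E1 * y $ idx5.E1)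
      + W e3 e1 * (x $ idx5.E3 * y $ idx5.E1)
      + x $ idx5.E2 * (W e2 x1 * y $ idx5.X1 + W e2 x2 * y $ idx5.X2)"
    by (subst W_expansion) (simp add: sum_idx5 e2 e3 xx e1x e3x e algebra_simps)
  have "(\<rho> x1 - 1) * W x2 e1 = 0" "\<rho> x2 * W x2 e1 = 0"
    using c[of x2 e1 x1] c[of x2 e1 x2] by (simp_all add: basis_bracket algebra_simps)
  then show "W x2 e1 \<noteq> 0 \<Longrightarrow> \<rho> x1 = 1 \<and> \<rho> x2 = 0" by auto
  have "(\<rho> x1 - 2) * W e1 e1 = 0" "\<rho> x2 * W e1 e1 = 0"
    using c[of e1 e1 x1] c[of e1 e1 x2] by (simp_all add: basis_bracket algebra_simps)
  then show "W e1 e1 \<noteq> 0 \<Longrightarrow> \<rho> x1 = 2 \<and> \<rho> x2 = 0" by auto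
  have "(\<rho> x1 - 2) * W e3 e1 = 0" "(\<rho> x2 - 1) * W e3 e1 = 0"
    using c[of e3 e1 x1] c[of e3 e1 x2] by (simp_all add: basis_bracket algebra_simps)
  then show "W e3 e1 \<noteq> 0 \<Longrightarrow> \<rho> x1 = 2 \<and> \<rho> x2 = 1" by auto
  \<comment> \<open>One equation ties two entries: the normalisation kills one and the equation the
    other, unless both of its coefficients vanish.\<close>
  have "(\<rho> x2 - 1) * W e2 x1 = \<rho> x1 * W e2 x2"
    using c[of e2 x1 x2] by (simp add: basis_bracket algebra_simps)
  then show "W e2 x1 \<noteq> 0 \<or> W e2 x2 \<noteq> 0 \<Longrightarrow> \<rho> x1 = 0 \<and> \<rho> x2 = 1"
    using e2_x1 e2_x2 by (cases "\<rho> x1 = 0"; cases "\<rho> x2 = 1"; auto)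
qed

text \<open>The case \<open>\<mu> = - \<rho>\<close>. All symmetrised brackets are combinations of
  \<open>e2\<close> and \<open>e3\<close>, where \<open>W\<close> vanishes in its second argument,
  so \<open>cocycle_sym\<close> makes \<open>W\<close> antisymmetric. Only the pairs of
  \<open>e1\<close> with \<open>x1\<close> and \<open>x2\<close> survive.\<close>

lemma antisymmetric_normalized:
  assumes \<mu>: "\<And>x. \<mu> x = - \<rho> x" and nz: "\<rho> x1 \<noteq> 0 \<or> \<rho> x2 \<noteq> 0"
    and e: "W e2 e1 = 0" "W e2 x2 + W x2 e2 = 0" "W x1 x2 = 0"
    and e1_x1: "\<rho> x1 \<noteq> 1 \<longrightarrow> W e1 x1 = 0"
    and e1_x2: "\<rho> x1 = 1 \<and> \<rho> x2 \<noteq> 0 \<longrightarrow> W e1 x2 = 0"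
  shows "W x y = W e1 x1 * (x $ idx5.E1 * y $ idx5.X1 - x $ idx5.X1 * y $ idx5.E1)
      + W e1 x2 * (x $ idx5.E1 * y $ idx5.X2 - x $ idx5.X2 * y $ idx5.E1)"
    and "W e1 x1 \<noteq> 0 \<or> W e1 x2 \<noteq> 0 \<Longrightarrow> \<rho> x1 = 1 \<and> \<rho> x2 = 0"
proof -
  obtain z where z: "\<rho> z \<noteq> 0" using nz by blast
  have sym: "\<rho> x * (W u v + W v u) = W x (L1_bracket u v + L1_bracket v u)" for x u v
    using cocycle_sym[of x u v] by (simp add: \<mu>)
  have anti: "W u v = - W v u" if "W z (L1_bracket u v + L1_bracket v u) = 0" for u v
    using sym[of z u v] z that by (simp add: eq_neg_iff_add_eq_0)
  have e2: "W x e2 = 0" for x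
    using sym[of x e2 x2] e by (simp add: basis_bracket)
  have e3: "W x e3 = 0" for x
    using sym[of x e2 e1] e e2 by (simp add: basis_bracket)
  have r: "W e1 e1 = 0" "W e3 e1 = 0" "W e3 x1 = 0" "W e3 x2 = 0" "W e2 x1 = 0" "W e2 x2 = 0"
      "W x1 x1 = 0" "W x2 x2 = 0" "W x2 x1 = 0" "W x1 e1 = - W e1 x1" "W x2 e1 = - W e1 x2"
    using anti[of e1 e1] anti[of e3 e1] anti[of e3 x1] anti[of e3 x2] anti[of e2 x1] anti[of x1 x1]
      anti[of x2 x2] anti[of x2 x1] anti[of x1 e1] anti[of x2 e1] e e2 e3
    by (auto simp: basis_bracket)
  show "W x y = W e1 x1 * (x $ idx5.E1 * y $ idx5.X1 - x $ idx5.X1 * y $ idx5.E1)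
      + W e1 x2 * (x $ idx5.E1 * y $ idx5.X2 - x $ idx5.X2 * y $ idx5.E1)"
    by (subst W_expansion) (simp add: sum_idx5 e2 e3 r e algebra_simps)
  have "(1 - \<rho> x1) * W e1 x2 + \<rho> x2 * W e1 x1 = 0"
    using cocycle[of e1 x1 x2] by (simp add: basis_bracket e algebra_simps)
  then show "W e1 x1 \<noteq> 0 \<or> W e1 x2 \<noteq> 0 \<Longrightarrow> \<rho> x1 = 1 \<and> \<rho> x2 = 0"
    using e1_x1 e1_x2 by (cases "\<rho> x1 = 1"; cases "\<rho> x2 = 0"; auto)
qed

text \<open>Only the \<open>E4\<close> coordinate is compared, because the other coordinates of
  every listed bracket are those of \<open>L1_bracket\<close>. In the second alternative
  \<open>g\<close> normalises the cocycle and \<open>d\<close> rescales the line.\<close>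

lemma coboundary_or_Lhat1:
  assumes nz: "\<rho> x1 \<noteq> 0 \<or> \<rho> x2 \<noteq> 0"
    and \<mu>: "(\<forall>x. \<mu> x = 0) \<or> (\<forall>x. \<mu> x = - \<rho> x)"
  obtains g where "Vector_Spaces.linear (*s) (*) g" "\<And>x y. W x y = scalar_coboundary \<mu> \<rho> g x y"
  | g k d where "Vector_Spaces.linear (*s) (*) g" "d \<noteq> 0"
      "\<And>x y s t. Lhat1_bracket k (lift x s) (lift y t) $ E4
        = d * (W x y - scalar_coboundary \<mu> \<rho> g x y) + \<mu> x * t + \<rho> y * s"
  using \<mu>
proof (elim disjE)
  assume \<mu>0: "\<forall>x. \<mu> x = 0"
  note coboundary = that(1) and extension = that(2)
  obtain z where z: "z = x1 \<or> z = x2" "\<rho> z \<noteq> 0" using nz by blast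
  \<comment> \<open>Each value solves the coboundary equation for one entry to be removed. For
    \<open>\<rho> x1 = 0\<close> and \<open>\<rho> x2 = 1\<close> division by zero gives
    \<open>g e2 = 0\<close>; there no coboundary changes \<open>W e2 x1\<close> or
    \<open>W e2 x2\<close>.\<close>
  obtain g where g: "Vector_Spaces.linear (*s) (*) g" and gb: "\<And>i. g (basis_vec i) = (case i of
      idx5.E1 \<Rightarrow> W x1 e1
    | idx5.E2 \<Rightarrow> if \<rho> x1 \<noteq> 0 then W e2 x1 / \<rho> x1 else W e2 x2 / (\<rho> x2 - 1)
    | idx5.E3 \<Rightarrow> - W e2 e1 | idx5.X1 \<Rightarrow> W x1 z / \<rho> z | idx5.X2 \<Rightarrow> W x2 z / \<rho> z)"
    using linear_form_exists by blast
  have g0: "g 0 = 0" "g (- x) = - g x" for x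
    using g[unfolded linear_form_iff, THEN conjunct2, rule_format, of 0 0]
      g[unfolded linear_form_iff, THEN conjunct2, rule_format, of "- 1" x]
    by simp_all
  define V where "V x y = W x y - scalar_coboundary \<mu> \<rho> g x y" for x y
  interpret V: L1_scalar_cocycle \<mu> \<rho> V
    unfolding V_def by (rule diff_coboundary[OF g])
  note simps = V_def scalar_coboundary_def \<mu>0[rule_format] basis_bracket g0 gb
  have Vz: "V x1 z = 0" "V x2 z = 0"
    using z by (auto simp: simps)
  have Ve: "V e2 e1 = 0" "V x1 e1 = 0"
    by (simp_all add: simps)
  have Ve2x1: "\<rho> x1 \<noteq> 0 \<longrightarrow> V e2 x1 = 0"
    by (simp add: simps)
  have Ve2x2: "\<rho> x1 = 0 \<and> \<rho> x2 \<noteq> 1 \<longrightarrow> V e2 x2 = 0"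
    by (simp add: simps divide_simps) (simp add: algebra_simps)
  define p q r u v a b where "p = V x2 e1" and "q = V e1 e1" and "r = V e3 e1" and "u = V e2 x1" and "v = V e2 x2"
    and "a = \<rho> x1" and "b = \<rho> x2"
  note defs = this
  note n = V.right_normalized[OF \<mu>0[rule_format] z Vz Ve Ve2x1 Ve2x2, folded defs]
  note expansion = n(1) and n = n(2-)
  note \<rho> = \<mu>_\<rho>_expansion(2)[folded defs]
  have conclude: thesis
    if "d \<noteq> 0" "\<And>x y s t. Lhat1_bracket k (lift x s) (lift y t) $ E4 = d * V x y + \<rho> y * s" for k d
    by (rule extension[OF g that(1), of k]) (simp add: that(2) V_def \<mu>0)
  \<comment> \<open>The weights forced by \<open>p\<close>, by \<open>q\<close>, by \<open>r\<close>
    and by the pair \<open>u\<close>, \<open>v\<close> are pairwise distinct, so at most one of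
    these four is nonzero.\<close>
  consider "p \<noteq> 0" | "q \<noteq> 0" | "r \<noteq> 0" | "u \<noteq> 0" "v = 0" | "v \<noteq> 0"
    | "p = 0" "q = 0" "r = 0" "u = 0" "v = 0"
    by blast
  then show thesis
  proof cases
    case 1
    then have "a = 1" "b = 0" "q = 0" "r = 0" "u = 0" "v = 0"
      using n by auto
    with 1 show thesis
      by (intro conclude[of "1 / p" A1])
        (auto simp: Lhat1_bracket_nth expansion \<rho>)
  next
    case 2
    then have "a = 2" "b = 0" "p = 0" "r = 0" "u = 0" "v = 0"
      using n by auto
    with 2 show thesis
      by (intro conclude[of "1 / q" A2])
        (auto simp: Lhat1_bracket_nth expansion \<rho>)
  next
    case 3
    then have "a = 2" "b = 1" "p = 0" "q = 0" "u = 0" "v = 0"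
      using n by auto
    with 3 show thesis
      by (intro conclude[of "1 / r" A3])
        (auto simp: Lhat1_bracket_nth expansion \<rho> algebra_simps)
  next
    case 4
    then have "a = 0" "b = 1" "p = 0" "q = 0" "r = 0"
      using n by auto
    with 4 show thesis
      by (intro conclude[of "1 / u" A4])
        (auto simp: Lhat1_bracket_nth expansion \<rho>)
  next
    case 5
    then have "a = 0" "b = 1" "p = 0" "q = 0" "r = 0"
      using n by auto
    \<comment> \<open>Scaling \<open>v\<close> to 1 leaves the ratio \<open>u / v\<close> as the
      parameter.\<close>
    with 5 show thesis
      by (intro conclude[of "1 / v" "A5 (u / v)"])
        (auto simp: Lhat1_bracket_nth expansion \<rho> field_simps)
  next
    case 6
    then have "V x y = 0" for x y by (simp add: expansion)
    then show thesis by (intro coboundary[OF g]) (simp add: V_def)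
  qed
next
  assume \<mu>: "\<forall>x. \<mu> x = - \<rho> x"
  note coboundary = that(1) and extension = that(2)
  \<comment> \<open>On \<open>x1\<close>, \<open>x2\<close> the coboundary is
    \<open>\<rho> x2 * g x1 - \<rho> x1 * g x2\<close>, solvable through whichever weight is
    nonzero. For \<open>\<rho> x1 = 1\<close> and \<open>\<rho> x2 = 0\<close>, \<open>g e1\<close>
    is 0 by division by zero, and no coboundary changes \<open>W e1 x1\<close> or
    \<open>W e1 x2\<close>.\<close>
  obtain g where g: "Vector_Spaces.linear (*s) (*) g" and gb: "\<And>i. g (basis_vec i) = (case i of
      idx5.E1 \<Rightarrow> if \<rho> x1 \<noteq> 1 then W e1 x1 / (\<rho> x1 - 1) else W e1 x2 / \<rho> x2
    | idx5.E2 \<Rightarrow> - (W e2 x2 + W x2 e2) | idx5.E3 \<Rightarrow> - W e2 e1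
    | idx5.X1 \<Rightarrow> if \<rho> x1 \<noteq> 0 then 0 else W x1 x2 / \<rho> x2
    | idx5.X2 \<Rightarrow> if \<rho> x1 \<noteq> 0 then - W x1 x2 / \<rho> x1 else 0)"
    using linear_form_exists by blast
  have g0: "g 0 = 0" "g (- x) = - g x" for x
    using g[unfolded linear_form_iff, THEN conjunct2, rule_format, of 0 0]
      g[unfolded linear_form_iff, THEN conjunct2, rule_format, of "- 1" x]
    by simp_all
  define V where "V x y = W x y - scalar_coboundary \<mu> \<rho> g x y" for x y
  interpret V: L1_scalar_cocycle \<mu> \<rho> V
    unfolding V_def by (rule diff_coboundary[OF g])
  note simps = V_def scalar_coboundary_def \<mu>[rule_format] basis_bracket g0 gb
  have Ve: "V e2 e1 = 0" "V e2 x2 + V x2 e2 = 0" "V x1 x2 = 0"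
    using nz by (auto simp: simps algebra_simps)
  have Ve1x1: "\<rho> x1 \<noteq> 1 \<longrightarrow> V e1 x1 = 0"
    by (simp add: simps divide_simps) (simp add: algebra_simps)
  have Ve1x2: "\<rho> x1 = 1 \<and> \<rho> x2 \<noteq> 0 \<longrightarrow> V e1 x2 = 0"
    by (simp add: simps)
  define p q a b where "p = V e1 x1" and "q = V e1 x2" and "a = \<rho> x1" and "b = \<rho> x2"
  note defs = this
  note n = V.antisymmetric_normalized[OF \<mu>[rule_format] nz Ve Ve1x1 Ve1x2, folded defs]
  note \<rho> = \<mu>_\<rho>_expansion(2)[folded defs]
  have conclude: thesis
    if "d \<noteq> 0" "\<And>x y s t. Lhat1_bracket k (lift x s) (lift y t) $ E4 = d * V x y - \<rho> x * t + \<rho> y * s" for k d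
    by (rule extension[OF g that(1), of k]) (simp add: that(2) V_def \<mu>)
  consider "p \<noteq> 0" "q = 0" | "q \<noteq> 0" | "p = 0" "q = 0"
    by blast
  then show thesis
  proof cases
    case 1
    with n(2) show thesis
      by (intro conclude[of "1 / p" A6])
        (auto simp: Lhat1_bracket_nth n(1) \<rho>)
  next
    case 2
    with n(2) show thesis
      by (intro conclude[of "1 / q" "A7 (p / q)"])
        (auto simp: Lhat1_bracket_nth n(1) \<rho> field_simps)
  next
    case 3
    then have "V x y = 0" for x y by (simp add: n(1))
    then show thesis by (intro coboundary[OF g]) (simp add: V_def)
  qed
qed

end

section \<open>Extensions by a line\<close>

lemma (in vector_space) line_coordinate:
  assumes "e \<noteq> 0" "span {e} = UNIV"
  obtains \<kappa> where "Vector_Spaces.linear scale (*) \<kappa>" "\<And>a. scale (\<kappa> a) e = a" "\<And>c. \<kappa> (scale c e) = c"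
proof -
  have "\<exists>c. scale c e = a" for a
    using assms(2) by (metis UNIV_I imageE span_singleton)
  then obtain \<kappa> where \<kappa>: "scale (\<kappa> a) e = a" for a by metis
  have eq: "\<kappa> a = c" if "scale c e = a" for a c
    using \<kappa>[of a] that assms(1) by (metis scale_cancel_right)
  have "vector_space ((*) :: 'a \<Rightarrow> 'a \<Rightarrow> 'a)"
    by unfold_locales (simp_all add: algebra_simps)
  then have "Vector_Spaces.linear scale (*) \<kappa>"
    unfolding Vector_Spaces.linear_iff
    by (auto intro!: eq simp: vector_space_axioms scale_left_distrib \<kappa> simp flip: scale_scale)
  then show thesis using \<kappa> eq by (intro that) auto
qed

text \<open>A coordinate on \<open>h\<close> reduces the claim to
  \<open>coboundary_or_Lhat1\<close>: a coboundary would split the extension, so the second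
  alternative holds and gives the isomorphism.\<close>

lemma isomorphic_Lhat1_extension:
  fixes sh :: "complex \<Rightarrow> 'h::ab_group_add \<Rightarrow> 'h"
  assumes "leibniz_cocycle (*s) L1_bracket sh l r \<omega>"
    and e4: "e4 \<noteq> 0" "module.span sh {e4} = UNIV"
    and N: "L1_N \<subseteq> rep_kernel l \<inter> rep_kernel r"
    and nontrivial: "rep_kernel l \<inter> rep_kernel r \<noteq> UNIV"
    and nonsplit: "\<not> split_extension (*s) L1_bracket sh \<omega> l r"
  shows "\<exists>k. isomorphic_algebras (module_prod.scale (*s) sh) (abelian_extension L1_bracket \<omega> l r)
    (*s) (Lhat1_bracket k)"
proof -
  interpret leibniz_cocycle "(*s)" L1_bracket sh l r \<omega> by fact
  interpret P: vector_space_prod "(*s) :: complex \<Rightarrow> complex ^ idx5 \<Rightarrow> _" sh ..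
  obtain \<kappa> where lin\<kappa>: "Vector_Spaces.linear sh (*) \<kappa>"
      and \<kappa>: "\<And>a. sh (\<kappa> a) e4 = a" "\<And>c. \<kappa> (sh c e4) = c"
    using h.line_coordinate[OF e4] by blast
  have \<kappa>_add: "\<kappa> (a + b) = \<kappa> a + \<kappa> b" and \<kappa>_scale: "\<kappa> (sh c a) = c * \<kappa> a" for a b c
    using lin\<kappa> by (auto simp: Vector_Spaces.linear_iff)
  have \<kappa>_inj: "\<kappa> a = \<kappa> b \<longleftrightarrow> a = b" for a b
    using \<kappa>(1) by metis
  have \<kappa>_zero: "\<kappa> 0 = 0"
    using \<kappa>_add[of 0 0] by simp
  then have \<kappa>_minus: "\<kappa> (- a) = - \<kappa> a" for a
    using \<kappa>_add[of a "- a"] by (simp add: eq_neg_iff_add_eq_0 add.commute)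
  have \<kappa>_diff: "\<kappa> (a - b) = \<kappa> a - \<kappa> b" for a b
    using \<kappa>_add[of a "- b"] by (simp add: \<kappa>_minus)
  have lin: "l (x + y) a = l x a + l y a" "l x (a + b) = l x a + l x b" "l (c *s x) a = sh c (l x a)" "l x (sh c a) = sh c (l x a)"
    "r (x + y) a = r x a + r y a" "r x (a + b) = r x a + r x b" "r (c *s x) a = sh c (r x a)" "r x (sh c a) = sh c (r x a)"
    "\<omega> (x + y) z = \<omega> x z + \<omega> y z" "\<omega> x (y + z) = \<omega> x y + \<omega> x z" "\<omega> (c *s x) y = sh c (\<omega> x y)" "\<omega> x (c *s y) = sh c (\<omega> x y)"
    for x y z a b c
    using bilinear_l bilinear_r bilinear_\<omega> by (auto simp: bilinear_map_def Vector_Spaces.linear_iff)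
  define \<mu> \<rho> W where "\<mu> x = \<kappa> (l x e4)" and "\<rho> x = \<kappa> (r x e4)" and "W x y = \<kappa> (\<omega> x y)" for x y
  have \<kappa>l: "\<kappa> (l x a) = \<mu> x * \<kappa> a" and \<kappa>r: "\<kappa> (r x a) = \<rho> x * \<kappa> a" for x a
    using lin(4)[of x "\<kappa> a" e4] lin(8)[of x "\<kappa> a" e4] by (simp_all add: \<kappa> \<kappa>_scale \<mu>_def \<rho>_def)
  have \<mu>\<mu>: "\<mu> x * \<mu> y = - \<mu> x * \<rho> y" for x y
    using l_l[of x y e4] \<kappa>(2)[of 1] unfolding \<kappa>_inj[symmetric] by (simp add: \<kappa>_minus \<kappa>l \<kappa>r)
  interpret V: L1_scalar_cocycle \<mu> \<rho> W
  proof (rule L1_scalar_cocycle.intro)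
    show "Vector_Spaces.linear (*s) (*) \<mu>" "Vector_Spaces.linear (*s) (*) \<rho>"
      by (simp_all add: linear_form_iff \<mu>_def \<rho>_def lin \<kappa>_add \<kappa>_scale)
    show "bilinear_map (*s) (*s) (*) W"
      by (simp add: bilinear_map_def linear_form_iff W_def lin \<kappa>_add \<kappa>_scale)
    show "\<mu> x = 0" "\<rho> x = 0" if "x \<in> L1_N" for x
      using N that by (auto simp: \<mu>_def \<rho>_def rep_kernel_def \<kappa>_zero)
    show "\<mu> x * \<mu> y = - \<mu> x * \<rho> y" for x y by (fact \<mu>\<mu>)
    show "W (L1_bracket x y) z - W x (L1_bracket y z) - W (L1_bracket x z) y
      - \<mu> x * W y z - \<rho> y * W x z + \<rho> z * W x y = 0" for x y z
      using cocycle[of x y z] unfolding \<kappa>_inj[symmetric]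
      by (simp add: \<kappa>_add \<kappa>_diff \<kappa>_zero \<kappa>l \<kappa>r W_def)
  qed
  \<comment> \<open>A single \<open>x\<close> with \<open>\<mu> x \<noteq> 0\<close> can be
    cancelled and gives \<open>\<mu> y = - \<rho> y\<close> for every \<open>y\<close>.\<close>
  have \<mu>_cases: "(\<forall>x. \<mu> x = 0) \<or> (\<forall>x. \<mu> x = - \<rho> x)"
    using \<mu>\<mu> by (metis mult_cancel_left mult_minus_left mult_minus_right)
  have nz: "\<rho> (basis_vec idx5.X1) \<noteq> 0 \<or> \<rho> (basis_vec idx5.X2) \<noteq> 0"
  proof (rule ccontr)
    assume "\<not> ?thesis"
    then have "\<rho> x = 0" for x using V.\<mu>_\<rho>_expansion(2)[of x] by simp
    with \<mu>_cases have "\<mu> x = 0" "\<rho> x = 0" for x by auto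
    then have "l x a = 0" "r x a = 0" for x a
      by (simp_all add: \<kappa>l \<kappa>r \<kappa>_zero flip: \<kappa>_inj)
    with nontrivial show False by (auto simp: rep_kernel_def)
  qed
  show ?thesis
  proof (rule V.coboundary_or_Lhat1[OF nz \<mu>_cases])
    fix g assume g: "Vector_Spaces.linear (*s) (*) g" and W: "\<And>x y. W x y = scalar_coboundary \<mu> \<rho> g x y"
    have gl: "g (x + y) = g x + g y" "g (c *s x) = c * g x" for x y c
      using g by (auto simp: linear_form_iff)
    \<comment> \<open>The graph of \<open>- g\<close> is closed under the bracket because
      \<open>W\<close> is the coboundary of \<open>g\<close>.\<close>
    define \<sigma> where "\<sigma> x = (x, - sh (g x) e4)" for x
    have "Vector_Spaces.linear (*s) P.scale \<sigma>"
      unfolding Vector_Spaces.linear_iff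
      by (auto simp: \<sigma>_def P.scale_def gl h.scale_left_distrib vec.vector_space_axioms P.p.vector_space_axioms)
    moreover have "\<sigma> (L1_bracket x y) = abelian_extension L1_bracket \<omega> l r (\<sigma> x) (\<sigma> y)" for x y
      using W[of x y]
      by (simp add: \<sigma>_def abelian_extension_def \<kappa>_add \<kappa>_minus \<kappa>l \<kappa>r \<kappa>(2) scalar_coboundary_def W_def flip: \<kappa>_inj)
    ultimately have "split_extension (*s) L1_bracket sh \<omega> l r"
      unfolding split_extension_def by (intro exI[of _ \<sigma>]) (simp add: \<sigma>_def)
    with nonsplit show ?thesis by blast
  next
    fix g k d
    assume g: "Vector_Spaces.linear (*s) (*) g" and d: "d \<noteq> 0"
      and E4: "\<And>x y s t. Lhat1_bracket k (lift x s) (lift y t) $ E4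
        = d * (W x y - scalar_coboundary \<mu> \<rho> g x y) + \<mu> x * t + \<rho> y * s"
    have gl: "g (x + y) = g x + g y" "g (c *s x) = c * g x" for x y c
      using g by (auto simp: linear_form_iff)
    \<comment> \<open>The shift by \<open>g\<close> removes the coboundary, and \<open>d\<close>
      scales the line.\<close>
    define \<phi> where "\<phi> p = lift (fst p) (d * (\<kappa> (snd p) + g (fst p)))" for p
    have "Vector_Spaces.linear P.scale (*s) \<phi>"
      unfolding Vector_Spaces.linear_iff
      by (auto simp: \<phi>_def P.scale_def gl vec_eq_idx6 \<kappa>_add \<kappa>_scale algebra_simps vec.vector_space_axioms P.p.vector_space_axioms)
    moreover have "bij \<phi>"
    proof (rule bijI)
      show "inj \<phi>"
      proof (rule injI)
        fix p q assume eq: "\<phi> p = \<phi> q"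
        then have fst: "fst p = fst q"
          by (simp add: \<phi>_def vec_eq_idx6 vec_eq_idx5)
        from eq have "snd p = snd q"
          using d by (simp add: \<phi>_def vec_eq_idx6 fst \<kappa>_inj)
        with fst show "p = q" by (rule prod_eqI)
      qed
      have "v \<in> range \<phi>" for v
      proof
        define x where "x = (\<chi> i. case i of idx5.E1 \<Rightarrow> v $ E1 | idx5.E2 \<Rightarrow> v $ E2 | idx5.E3 \<Rightarrow> v $ E3
          | idx5.X1 \<Rightarrow> v $ X1 | idx5.X2 \<Rightarrow> v $ X2)"
        show "v = \<phi> (x, sh (v $ E4 / d - g x) e4)"
          using d by (simp add: \<phi>_def vec_eq_idx6 \<kappa>(2)) (simp add: x_def)
      qed simp
      then show "surj \<phi>" by blast
    qed
    moreover have "\<phi> (abelian_extension L1_bracket \<omega> l r p q) = Lhat1_bracket k (\<phi> p) (\<phi> q)" for p q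
    proof -
      have "\<phi> (abelian_extension L1_bracket \<omega> l r p q) $ E4 = Lhat1_bracket k (\<phi> p) (\<phi> q) $ E4"
        unfolding \<phi>_def E4
        by (cases p; cases q)
          (simp add: abelian_extension_def \<kappa>_add \<kappa>l \<kappa>r W_def scalar_coboundary_def algebra_simps)
      then show ?thesis
        unfolding vec_eq_idx6
        by (cases p; cases q) (simp add: \<phi>_def Lhat1_bracket_nth(1-5) abelian_extension_def)
    qed
    ultimately show ?thesis unfolding isomorphic_algebras_def by blast
  qed
qed

section \<open>Pairwise non-isomorphism\<close>


lemma trace_conjugate:
  fixes \<phi> f g :: "'a::field ^ 'n \<Rightarrow> 'a ^ 'n"
  assumes \<phi>: "Vector_Spaces.linear (*s) (*s) \<phi>" "bij \<phi>"
    and f: "Vector_Spaces.linear (*s) (*s) f" and g: "Vector_Spaces.linear (*s) (*s) g"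
    and comm: "\<And>x. \<phi> (f x) = g (\<phi> x)"
  shows "(\<Sum>i\<in>UNIV. f (axis i 1) $ i) = (\<Sum>i\<in>UNIV. g (axis i 1) $ i)"
proof -
  obtain \<psi> where \<psi>: "Vector_Spaces.linear (*s) (*s) \<psi>" "\<psi> \<circ> \<phi> = id"
    using vec.linear_injective_left_inverse[OF \<phi>(1)] \<phi>(2) by (auto simp: bij_is_inj)
  have "\<phi> \<circ> \<psi> = id"
    using \<psi>(2) \<phi>(2) by (metis bij_is_surj comp_assoc surj_fun_eq comp_id id_comp)
  then have "g = g \<circ> (\<phi> \<circ> \<psi>)" by simp
  also have "\<dots> = \<phi> \<circ> (f \<circ> \<psi>)" using comm by (auto simp: fun_eq_iff)
  finally have g': "matrix g = matrix \<phi> ** matrix (f \<circ> \<psi>)"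
    using f \<phi>(1) \<psi>(1) by (metis matrix_compose_gen Vector_Spaces.linear_compose)
  have "f = (f \<circ> \<psi>) \<circ> \<phi>" using \<psi>(2) by (simp add: comp_assoc)
  then have "matrix f = matrix (f \<circ> \<psi>) ** matrix \<phi>"
    using f \<phi>(1) \<psi>(1) by (metis matrix_compose_gen Vector_Spaces.linear_compose)
  then have "trace (matrix f) = trace (matrix g)" unfolding g' by (metis trace_mul_sym)
  then show ?thesis by (simp add: trace_def matrix_def)
qed

text \<open>The element \<open>e4\<close> is an eigenvector of right multiplication by \<open>x1\<close> and \<open>x2\<close>, with eigenvalues
  \<open>weight1\<close> and \<open>weight2\<close>, and of left multiplication by \<open>x1\<close>, with eigenvalue \<open>- left_weight\<close>.\<close>

primrec weight1 :: "label \<Rightarrow> complex" where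
  "weight1 A1 = 1" | "weight1 A2 = 2" | "weight1 A3 = 2" | "weight1 A4 = 0"
| "weight1 (A5 \<delta>) = 0" | "weight1 A6 = 1" | "weight1 (A7 \<delta>) = 1"

primrec weight2 :: "label \<Rightarrow> complex" where
  "weight2 A1 = 0" | "weight2 A2 = 0" | "weight2 A3 = 1" | "weight2 A4 = 1"
| "weight2 (A5 \<delta>) = 1" | "weight2 A6 = 0" | "weight2 (A7 \<delta>) = 0"

primrec left_weight :: "label \<Rightarrow> complex" where
  "left_weight A1 = 0" | "left_weight A2 = 0" | "left_weight A3 = 0" | "left_weight A4 = 0"
| "left_weight (A5 \<delta>) = 0" | "left_weight A6 = 1" | "left_weight (A7 \<delta>) = 1"

text \<open>In the basis order \<open>X1\<close>, \<open>X2\<close>, \<open>E1\<close>,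
  \<open>E2\<close>, \<open>E3\<close>, \<open>E4\<close> all left and right multiplications are
  triangular, so only the weights of the basis vectors enter.\<close>

lemma Lhat1_traces:
  "(\<Sum>i\<in>UNIV. Lhat1_bracket k y (basis_vec i) $ i) = - (1 + left_weight k) * y $ X1"
  "(\<Sum>i\<in>UNIV. Lhat1_bracket k (basis_vec i) y $ i) = (2 + weight1 k) * y $ X1 + (2 + weight2 k) * y $ X2"
  "(\<Sum>i\<in>UNIV. Lhat1_bracket k (Lhat1_bracket k (basis_vec i) y) z $ i) =
    (2 + weight1 k ^ 2) * y $ X1 * z $ X1 + (1 + weight1 k * weight2 k) * (y $ X1 * z $ X2 + y $ X2 * z $ X1)
    + (2 + weight2 k ^ 2) * y $ X2 * z $ X2"
  by (cases k; simp add: sum_idx6 Lhat1_bracket_nth; simp add: axis_def algebra_simps power2_eq_square)+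

lemma linear_Lhat1_bracket:
  "Vector_Spaces.linear (*s) (*s) (Lhat1_bracket k x)"
  "Vector_Spaces.linear (*s) (*s) (\<lambda>x. Lhat1_bracket k x y)"
  using leibniz_algebra.bilinear_br[OF leibniz_algebra_Lhat1] by (auto simp: bilinear_map_def)

lemma basis_vec_nth: "basis_vec i $ j = (if j = i then 1 else 0)"
  by (simp add: axis_def)

text \<open>The three traces, evaluated at the basis vectors \<open>X1\<close> and
  \<open>X2\<close>, give polynomial equations for the four coordinates; the finite list of weights
  leaves one solution.\<close>

lemma Lhat1_isomorphism_weights:
  assumes lin: "Vector_Spaces.linear (*s) (*s) \<phi>" and bij: "bij \<phi>"
    and hom: "\<And>x y. \<phi> (Lhat1_bracket k x y) = Lhat1_bracket k' (\<phi> x) (\<phi> y)"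
  shows "left_weight k' = left_weight k" "weight1 k' = weight1 k" "weight2 k' = weight2 k"
    "\<phi> (basis_vec X1) $ X1 = 1" "\<phi> (basis_vec X1) $ X2 = 0"
    "\<phi> (basis_vec X2) $ X1 = 0" "\<phi> (basis_vec X2) $ X2 = 1"
proof -
  note tr = trace_conjugate[OF lin bij]
  have L: "(1 + left_weight k') * \<phi> y $ X1 = (1 + left_weight k) * y $ X1" for y
    using tr[OF linear_Lhat1_bracket(1) linear_Lhat1_bracket(1) hom, of y]
    unfolding Lhat1_traces by algebra
  have R: "(2 + weight1 k') * \<phi> y $ X1 + (2 + weight2 k') * \<phi> y $ X2
      = (2 + weight1 k) * y $ X1 + (2 + weight2 k) * y $ X2" for y
    using tr[OF linear_Lhat1_bracket(2) linear_Lhat1_bracket(2) hom, of y] by (simp add: Lhat1_traces)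
  have RR: "(2 + weight1 k' ^ 2) * \<phi> y $ X1 * \<phi> z $ X1
      + (1 + weight1 k' * weight2 k') * (\<phi> y $ X1 * \<phi> z $ X2 + \<phi> y $ X2 * \<phi> z $ X1)
      + (2 + weight2 k' ^ 2) * \<phi> y $ X2 * \<phi> z $ X2 =
    (2 + weight1 k ^ 2) * y $ X1 * z $ X1 + (1 + weight1 k * weight2 k) * (y $ X1 * z $ X2 + y $ X2 * z $ X1)
      + (2 + weight2 k ^ 2) * y $ X2 * z $ X2" for y z
  proof -
    have l: "Vector_Spaces.linear (*s) (*s) (\<lambda>x. Lhat1_bracket k (Lhat1_bracket k x y) z)" for k y z
      using Vector_Spaces.linear_compose[OF linear_Lhat1_bracket(2)[of k y] linear_Lhat1_bracket(2)[of k z]]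
      by (simp add: o_def)
    show ?thesis
      using tr[OF l l, of k y z k' "\<phi> y" "\<phi> z"] by (simp add: Lhat1_traces hom)
  qed
  define p q s t where "p = \<phi> (basis_vec X1) $ X1" and "q = \<phi> (basis_vec X1) $ X2"
    and "s = \<phi> (basis_vec X2) $ X1" and "t = \<phi> (basis_vec X2) $ X2"
  note pqst = p_def[symmetric] q_def[symmetric] s_def[symmetric] t_def[symmetric]
  have "1 + left_weight k' \<noteq> 0" by (cases k') auto
  \<comment> \<open>Traces of left multiplications see the \<open>X1\<close> coordinate
    alone.\<close>
  then have s: "s = 0" using L[of "basis_vec X2"] by (auto simp: pqst basis_vec_nth)
  have R2: "(2 + weight2 k') * t = 2 + weight2 k"
    using R[of "basis_vec X2"] by (simp add: pqst s basis_vec_nth)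
  have RR22: "(2 + weight2 k' ^ 2) * t * t = 2 + weight2 k ^ 2"
    using RR[of "basis_vec X2" "basis_vec X2"] by (simp add: pqst s basis_vec_nth)
  \<comment> \<open>Each \<open>weight2\<close> is 0 or 1, so \<open>R2\<close> and \<open>RR22\<close> have equal right-hand sides.\<close>
  have idem: "weight2 j ^ 2 = weight2 j" and pos: "2 + weight2 j \<noteq> 0" for j by (cases j; simp)+
  have "(2 + weight2 k) * t = 2 + weight2 k" using R2 RR22 by (simp add: idem)
  then have t: "t = 1" using pos[of k] by simp
  then have w2: "weight2 k' = weight2 k" using R2 by simp
  have p: "(1 + left_weight k') * p = 1 + left_weight k"
    using L[of "basis_vec X1"] by (simp add: pqst basis_vec_nth)
  have R1: "(2 + weight1 k') * p + (2 + weight2 k) * q = 2 + weight1 k"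
    using R[of "basis_vec X1"] by (simp add: pqst w2 basis_vec_nth)
  have RR12: "(1 + weight1 k' * weight2 k) * p + (2 + weight2 k) * q = 1 + weight1 k * weight2 k"
    using RR[of "basis_vec X1" "basis_vec X2"] by (simp add: pqst s t w2 idem basis_vec_nth)
  have RR11: "(2 + weight1 k' ^ 2) * p * p + (1 + weight1 k' * weight2 k) * (2 * p * q) + (2 + weight2 k) * q * q = 2 + weight1 k ^ 2"
    using RR[of "basis_vec X1" "basis_vec X1"] by (simp add: pqst w2 idem basis_vec_nth mult.assoc)
  \<comment> \<open>Subtracting \<open>RR12\<close> from \<open>R1\<close> eliminates
    \<open>q\<close>; afterwards the left traces eliminate \<open>p\<close>.\<close>
  have "(1 + weight1 k' - weight1 k' * weight2 k) * p
      = ((2 + weight1 k') * p + (2 + weight2 k) * q) - ((1 + weight1 k' * weight2 k) * p + (2 + weight2 k) * q)"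
    by (simp add: algebra_simps)
  also have "\<dots> = 1 + weight1 k - weight1 k * weight2 k"
    unfolding R1 RR12 by simp
  finally have "(1 + left_weight k) * (1 + weight1 k' - weight1 k' * weight2 k)
      = (1 + left_weight k') * (1 + weight1 k - weight1 k * weight2 k)"
    unfolding p[symmetric] by (metis mult.assoc mult.commute)
  then have lw: "left_weight k' = left_weight k" and w1: "weight2 k = 0 \<Longrightarrow> weight1 k' = weight1 k"
    using w2 by (cases k; cases k'; simp)+
  have p1: "p = 1"
    using p unfolding lw by (cases k; simp)
  have Nq: "(2 + weight2 k) * q = weight1 k - weight1 k'"
    using R1 unfolding p1 by (simp add: algebra_simps)
  \<comment> \<open>For \<open>weight2 k = 1\<close> the relation above loses
    \<open>weight1\<close>. There \<open>RR11\<close> decides, multiplied by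
    \<open>2 + weight2 k\<close> so that \<open>Nq\<close> can eliminate \<open>q\<close>.\<close>
  have "(2 + weight2 k) * (2 + weight1 k' ^ 2) + 2 * (1 + weight1 k' * weight2 k) * ((2 + weight2 k) * q)
      + ((2 + weight2 k) * q)^2 = (2 + weight2 k) * (2 + weight1 k ^ 2)"
    unfolding RR11[symmetric] p1 by (simp add: algebra_simps power2_eq_square)
  then have w1: "weight1 k' = weight1 k"
    using w1 w2 unfolding Nq by (cases k; cases k'; simp)
  have q: "q = 0"
    using Nq pos[of k] unfolding w1 by simp
  show "left_weight k' = left_weight k" "weight1 k' = weight1 k" "weight2 k' = weight2 k"
    "\<phi> (basis_vec X1) $ X1 = 1" "\<phi> (basis_vec X1) $ X2 = 0"
    "\<phi> (basis_vec X2) $ X1 = 0" "\<phi> (basis_vec X2) $ X2 = 1"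
    using lw w1 w2 p1 q s t by (simp_all add: pqst)
qed


text \<open>In the families \<open>A4\<close>, \<open>A5\<close> (resp. \<open>A6\<close>, \<open>A7\<close>), \<open>e4\<close> has the same weight as \<open>e2\<close> (resp. \<open>e1\<close>), and
  \<open>jordan1\<close>, \<open>jordan2\<close> are the coefficients of the nilpotent parts of right multiplication by \<open>x1\<close>,
  \<open>x2\<close> on the common generalised weight space. Only their ratio is an invariant.\<close>

primrec jordan1 :: "label \<Rightarrow> complex" where
  "jordan1 A1 = 0" | "jordan1 A2 = 0" | "jordan1 A3 = 0" | "jordan1 A4 = 1"
| "jordan1 (A5 \<delta>) = \<delta>" | "jordan1 A6 = 1" | "jordan1 (A7 \<delta>) = \<delta>"

primrec jordan2 :: "label \<Rightarrow> complex" where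
  "jordan2 A1 = 0" | "jordan2 A2 = 0" | "jordan2 A3 = 0" | "jordan2 A4 = 0"
| "jordan2 (A5 \<delta>) = 1" | "jordan2 A6 = 0" | "jordan2 (A7 \<delta>) = 1"

text \<open>\<open>a\<close> is the \<open>E4\<close> coordinate of the image of \<open>E4\<close>,
  and \<open>c\<close> the \<open>E2\<close> (resp. \<open>E1\<close>) coordinate of the image of
  \<open>E2\<close> (resp. \<open>E1\<close>). The equations compare \<open>E4\<close> coordinates
  of the images of products with \<open>X1\<close> and \<open>X2\<close>.\<close>

lemma Lhat1_isomorphism_jordan:
  assumes lin: "Vector_Spaces.linear (*s) (*s) \<phi>" and bij: "bij \<phi>"
    and hom: "\<And>x y. \<phi> (Lhat1_bracket k x y) = Lhat1_bracket k' (\<phi> x) (\<phi> y)"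
    and k: "k \<notin> {A1, A2, A3}" "k' \<notin> {A1, A2, A3}"
  obtains a c where "a \<noteq> 0" "jordan1 k' * c = jordan1 k * a" "jordan2 k' * c = jordan2 k * a"
proof -
  note w = Lhat1_isomorphism_weights[OF lin bij hom]
  interpret Vector_Spaces.linear "(*s)" "(*s)" \<phi> by (rule lin)
  define u where "u = \<phi> (basis_vec E4)"
  have "u \<noteq> 0"
    using injD[OF bij_is_inj[OF bij], of "basis_vec E4" 0] unfolding u_def zero by (auto simp: axis_eq_0_iff)
  have brX: "\<phi> (Lhat1_bracket k x y) $ X1 = 0" "\<phi> (Lhat1_bracket k x y) $ X2 = 0" for x y
    by (simp_all add: hom Lhat1_bracket_nth)
  show ?thesis
  proof (cases "weight2 k = 1")
    case True
    then have wk: "k = A4 \<or> (\<exists>\<delta>. k = A5 \<delta>)" "k' = A4 \<or> (\<exists>\<delta>. k' = A5 \<delta>)"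
      using k w(3) by (cases k; cases k'; simp)+
    define v where "v = \<phi> (basis_vec E2)"
    have b: "Lhat1_bracket k (basis_vec E2) (basis_vec X1) = jordan1 k *s basis_vec E4"
      "Lhat1_bracket k (basis_vec E2) (basis_vec X2) = basis_vec E2 + jordan2 k *s basis_vec E4"
      "Lhat1_bracket k (basis_vec E4) (basis_vec X1) = 0"
      "Lhat1_bracket k (basis_vec E4) (basis_vec X2) = basis_vec E4"
      using wk(1) by (auto simp: vec_eq_idx6 Lhat1_bracket_nth basis_vec_nth)
    have E4: "Lhat1_bracket k' x y $ E4 = jordan1 k' * x $ E2 * y $ X1 + jordan2 k' * x $ E2 * y $ X2 + x $ E4 * y $ X2" for x y
      using wk(2) by (auto simp: Lhat1_bracket_nth)
    note eqs = b[THEN arg_cong[of _ _ "\<lambda>x. \<phi> x $ i" for i], unfolded hom add scale, folded u_def v_def, simplified]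
    have uX: "u $ X1 = 0" "u $ X2 = 0"
      using brX[of "basis_vec E4" "basis_vec X2"] by (simp_all add: b u_def)
    have u1: "u $ E1 = 0"
      using eqs(3)[of E1] by (simp add: Lhat1_bracket_nth w uX)
    \<comment> \<open>One of \<open>jordan1 k\<close>, \<open>jordan2 k\<close> equals 1, and the
      corresponding equation isolates \<open>u $ E2\<close>.\<close>
    have u2: "u $ E2 = 0"
      using eqs(1,2)[of E2] wk(1) by (auto simp add: Lhat1_bracket_nth w uX)
    have u3: "u $ E3 = 0"
      using eqs(3)[of E3] by (simp add: Lhat1_bracket_nth w uX u2)
    have u4: "u $ E4 \<noteq> 0"
      using \<open>u \<noteq> 0\<close> uX u1 u2 u3 by (simp add: vec_eq_idx6)
    show ?thesis
    proof (rule that[OF u4])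
      show "jordan1 k' * v $ E2 = jordan1 k * u $ E4"
        using eqs(1)[of E4] by (simp add: E4 w)
      show "jordan2 k' * v $ E2 = jordan2 k * u $ E4"
        using eqs(2)[of E4] by (simp add: E4 w)
    qed
  next
    case False
    then have wk: "k = A6 \<or> (\<exists>\<delta>. k = A7 \<delta>)" "k' = A6 \<or> (\<exists>\<delta>. k' = A7 \<delta>)"
      using k w(3) by (cases k; cases k'; simp)+
    define v where "v = \<phi> (basis_vec E1)"
    have b: "Lhat1_bracket k (basis_vec E1) (basis_vec X1) = basis_vec E1 + jordan1 k *s basis_vec E4"
      "Lhat1_bracket k (basis_vec E1) (basis_vec X2) = jordan2 k *s basis_vec E4"
      "Lhat1_bracket k (basis_vec E4) (basis_vec X1) = basis_vec E4"
      "Lhat1_bracket k (basis_vec E4) (basis_vec X2) = 0"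
      using wk(1) by (auto simp: vec_eq_idx6 Lhat1_bracket_nth basis_vec_nth)
    have E4: "Lhat1_bracket k' x y $ E4 = jordan1 k' * (x $ E1 * y $ X1 - x $ X1 * y $ E1)
        + jordan2 k' * (x $ E1 * y $ X2 - x $ X2 * y $ E1) + x $ E4 * y $ X1 - x $ X1 * y $ E4" for x y
      using wk(2) by (auto simp: Lhat1_bracket_nth)
    note eqs = b[THEN arg_cong[of _ _ "\<lambda>x. \<phi> x $ i" for i], unfolded hom add scale, folded u_def v_def, simplified]
    have uX: "u $ X1 = 0" "u $ X2 = 0"
      using brX[of "basis_vec E4" "basis_vec X1"] by (simp_all add: b u_def)
    \<comment> \<open>Brackets have no \<open>X1\<close> or \<open>X2\<close> coordinate, and
      \<open>v + jordan1 k *s u\<close> is the image of one.\<close>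
    have vX: "v $ X1 = 0" "v $ X2 = 0"
      using brX[of "basis_vec E1" "basis_vec X1"] uX by (simp_all add: b u_def v_def add scale)
    have u1: "u $ E1 = 0"
      using eqs(1,2)[of E1] wk(1) by (auto simp add: Lhat1_bracket_nth w uX vX)
    have u2: "u $ E2 = 0"
      using eqs(3)[of E2] by (simp add: Lhat1_bracket_nth w uX)
    have u3: "u $ E3 = 0"
      using eqs(4)[of E3] by (simp add: Lhat1_bracket_nth w uX u2)
    have u4: "u $ E4 \<noteq> 0"
      using \<open>u \<noteq> 0\<close> uX u1 u2 u3 by (simp add: vec_eq_idx6)
    show ?thesis
    proof (rule that[OF u4])
      show "jordan1 k' * v $ E1 = jordan1 k * u $ E4"
        using eqs(1)[of E4] by (simp add: E4 w vX)
      show "jordan2 k' * v $ E1 = jordan2 k * u $ E4"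
        using eqs(2)[of E4] by (simp add: E4 w vX)
    qed
  qed
qed

text \<open>The weights separate all labels except within \<open>A4\<close>, \<open>A5\<close> and
  within \<open>A6\<close>, \<open>A7\<close>. There \<open>(jordan1, jordan2)\<close> is
  \<open>(1, 0)\<close> or \<open>(\<delta>, 1)\<close>, one representative for each point of the
  projective line, so proportional pairs are equal.\<close>

lemma Lhat1_isomorphic_imp_eq:
  assumes "isomorphic_algebras (*s) (Lhat1_bracket k) (*s) (Lhat1_bracket k')"
  shows "k = k'"
proof -
  obtain \<phi> where \<phi>: "Vector_Spaces.linear (*s) (*s) \<phi>" "bij \<phi>"
      "\<And>x y. \<phi> (Lhat1_bracket k x y) = Lhat1_bracket k' (\<phi> x) (\<phi> y)"
    using assms by (auto simp: isomorphic_algebras_def)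
  note w = Lhat1_isomorphism_weights(1-3)[OF \<phi>]
  show ?thesis
  proof (cases "k \<in> {A1, A2, A3} \<or> k' \<in> {A1, A2, A3}")
    case True
    then show ?thesis using w by (cases k; cases k'; simp)
  next
    case False
    then obtain a c where "a \<noteq> 0" "jordan1 k' * c = jordan1 k * a" "jordan2 k' * c = jordan2 k * a"
      using Lhat1_isomorphism_jordan[OF \<phi>] by blast
    then show ?thesis using w False by (cases k; cases k'; auto)
  qed
qed

theorem theorem4p8:
  shows "(\<forall>(sh :: complex \<Rightarrow> 'h::ab_group_add \<Rightarrow> 'h) (e4 :: 'h) l r \<omega>.
      leibniz_cocycle (*s) L1_bracket sh l r \<omega> \<longrightarrow>
      e4 \<noteq> 0 \<longrightarrow> module.span sh {e4} = UNIV \<longrightarrow>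
      L1_N \<subseteq> rep_kernel l \<inter> rep_kernel r \<longrightarrow>
      rep_kernel l \<inter> rep_kernel r \<noteq> UNIV \<longrightarrow>
      \<not> split_extension (*s) L1_bracket sh \<omega> l r \<longrightarrow>
      (\<exists>k. isomorphic_algebras (module_prod.scale (*s) sh) (abelian_extension L1_bracket \<omega> l r)
             (*s) (Lhat1_bracket k))) \<and>
    (\<forall>k k'. k \<noteq> k' \<longrightarrow>
      \<not> isomorphic_algebras (*s) (Lhat1_bracket k) (*s) (Lhat1_bracket k'))"
  using isomorphic_Lhat1_extension Lhat1_isomorphic_imp_eq by blast

end
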